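(* Consider the dynamic competitive equilibrium skill distributions $\{F_t\}_{t\ge0}$ described in the context and let $x_t=\min\operatorname{supp}F_t$. Suppose $1-F_0\in\mathrm{RV}_{-1/\theta}$ with $\theta\in(0,1)$. Then the asymptotic distribution $\Phi$ of normalized skills $q/x_t$, defined by $1-\Phi(z)=\lim_{t\to\infty}\bigl[1-F_t(zx_t)\bigr]$, exists and is Pareto with scale $1$ and shape $1/\theta$: $$\Phi(z)=1-z^{-1/\theta}\qquad\text{for all } z\ge 1 .$$ Consequently, for large $t$, $F_t$ is approximately Pareto with time-varying scale $x_t$ and constant shape $1/\theta$, in the sense that for every $z\ge1$ the difference between $F_t$ and the Pareto CDF $q\mapsto 1-(q/x_t)^{-1/\theta}$, evaluated at $q=zx_t$, tends to $0$ as $t\to\infty$.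
   Context: Parameters: $\rho>0$, $m>h>0$, $0<I<N$ with $N-I>1$. $F_0$ is a CDF with finite mean and a continuous, strictly positive density on its support $[x_0,\infty)$, where $x_0>\frac{\rho I}{h^N[(m/h)^I-1]}$. The allocation part $\{a_t,F_t\}_{t\ge 0}$ of the dynamic competitive equilibrium ($F_t$ is the CDF of expert skills at date $t$, and $a_t$ the skill of the marginal active expert; each active expert hires $N-I$ novices, who inherit her skill) is determined, given $F_0$, by the market-clearing condition $$1=(N-I)[1-F_t(a_t)]\qquad (t\ge 0)$$ and the law of motion $$F_{t+1}(q)=0 \text{ if } q\le a_t,\qquad F_{t+1}(q)=(N-I)[F_t(q)-F_t(a_t)]\text{ if } q>a_t .$$ $1-F_0\in\mathrm{RV}_{-1/\theta}$ (regular variation) means $\lim_{q\to\infty}\frac{1-F_0(\lambda q)}{1-F_0(q)}=\lambda^{-1/\theta}$ for all $\lambda>0$. *)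

theory Defs
  imports "HOL-Probability.Probability"
begin

text \<open>The topological support of the law with CDF \<open>F\<close>: the points all of whose
  neighbourhoods carry mass.\<close>

definition cdf_support :: "(real \<Rightarrow> real) \<Rightarrow> real set" where
  "cdf_support F = {q. \<forall>e>0. F (q - e) < F (q + e)}"

definition min_support :: "(real \<Rightarrow> real) \<Rightarrow> real" where
  "min_support F = (LEAST q. q \<in> cdf_support F)"

definition regularly_varying :: "real \<Rightarrow> (real \<Rightarrow> real) \<Rightarrow> bool" where
  "regularly_varying \<alpha> U \<longleftrightarrow>
     (\<forall>l>0. ((\<lambda>q. U (l * q) / U q) \<longlongrightarrow> l powr \<alpha>) at_top)"

text \<open>The density may be prescribed arbitrarily off \<open>{x0..}\<close>; only its restriction matters.\<close>

definition has_positive_density_on_support :: "real measure \<Rightarrow> real \<Rightarrow> bool" where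
  "has_positive_density_on_support M x0 \<longleftrightarrow>
     cdf_support (cdf M) = {x0..} \<and>
     (\<exists>f. continuous_on {x0..} f \<and> (\<forall>q\<ge>x0. f q > 0) \<and>
          M = density lborel (\<lambda>q. ennreal (f q) * indicator {x0..} q))"

text \<open>The allocation part \<open>(a, F)\<close> of the dynamic competitive equilibrium started at \<open>F0\<close>:
  market clearing and law of motion. The team parameters \<open>N\<close> and \<open>I\<close> are real numbers.\<close>

definition equilibrium_allocation ::
    "real \<Rightarrow> real \<Rightarrow> (real \<Rightarrow> real) \<Rightarrow> (nat \<Rightarrow> real) \<Rightarrow> (nat \<Rightarrow> real \<Rightarrow> real) \<Rightarrow> bool" where
  "equilibrium_allocation N I F0 a F \<longleftrightarrow>
     F 0 = F0 \<and>
     (\<forall>t. 1 = (N - I) * (1 - F t (a t))) \<and>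
     (\<forall>t q. F (Suc t) q = (if q \<le> a t then 0 else (N - I) * (F t q - F t (a t))))"

definition pareto_cdf :: "real \<Rightarrow> real \<Rightarrow> real \<Rightarrow> real" where
  "pareto_cdf s k q = (if q < s then 0 else 1 - (q / s) powr (- k))"

text \<open>The value is meaningful only where the limit exists.\<close>

definition asymptotic_cdf :: "(nat \<Rightarrow> real \<Rightarrow> real) \<Rightarrow> real \<Rightarrow> real" where
  "asymptotic_cdf F z = 1 - lim (\<lambda>t. 1 - F t (z * min_support (F t)))"

end

theory Submission imports Defs begin

text \<open>Each step of the law of motion truncates the distribution at the cutoff \<open>a t\<close> and
  rescales it, so on its support \<open>F t\<close> has survival function \<open>(N - I) ^ t * (1 - F0)\<close>, and
  market clearing makes \<open>a t\<close> the next minimum of the support. As the survival function equals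
  \<open>1\<close> at that minimum \<open>x\<close>, the normalized survival function is
  \<open>(1 - F0 (z * x)) / (1 - F0 x)\<close> and \<open>x\<close> tends to infinity; regular variation concludes.\<close>

text \<open>Every neighbourhood of \<open>b\<close> carries mass because \<open>F\<close> increases
  strictly from \<open>F b = 0\<close>. A point \<open>q < b\<close> has the neighbourhood of radius
  \<open>b - q\<close>, which ends at \<open>b\<close> and carries none.\<close>

lemma min_support_eqI:
  fixes b :: real
  assumes zero: "\<And>q. q \<le> b \<Longrightarrow> F q = 0" and mono: "strict_mono_on {b..} F"
  shows "min_support F = b"
proof -
  have less: "F p < F q" if "p < q" "b < q" for p q
  proof (cases "b \<le> p")
    case True
    then show ?thesis using that by (intro strict_mono_onD[OF mono]) auto
  next
    case False
    have "F b < F q" using that by (intro strict_mono_onD[OF mono]) auto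
    then show ?thesis using False zero[of p] zero[of b] by simp
  qed
  have "b \<in> cdf_support F"
    unfolding cdf_support_def by (auto intro!: less)
  moreover have "b \<le> q" if "q \<in> cdf_support F" for q
  proof (rule ccontr)
    assume "\<not> b \<le> q"
    then have "0 < b - q" by simp
    then have "F (q - (b - q)) < F (q + (b - q))"
      using that unfolding cdf_support_def by blast
    then show False using zero[of b] zero[of "q - (b - q)"] \<open>\<not> b \<le> q\<close> by simp
  qed
  ultimately show ?thesis
    unfolding min_support_def by (intro Least_equality)
qed

text \<open>The interval from \<open>p\<close> to \<open>q\<close> is a symmetric neighbourhood of
  its midpoint, and the midpoint lies in the support.\<close>

lemma strict_mono_on_if_cdf_support:
  assumes "cdf_support F = {b..}"
  shows "strict_mono_on {b..} F"
proof (rule strict_mono_onI)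
  fix p q assume "p \<in> {b..}" "p < q"
  then have "(p + q) / 2 \<in> cdf_support F" using assms by auto
  then have "F ((p + q) / 2 - (q - p) / 2) < F ((p + q) / 2 + (q - p) / 2)"
    using \<open>p < q\<close> unfolding cdf_support_def by (auto simp del: add_diff_eq)
  moreover have "(p + q) / 2 - (q - p) / 2 = p" "(p + q) / 2 + (q - p) / 2 = q"
    by (simp_all add: field_simps)
  ultimately show "F p < F q" by simp
qed

text \<open>The support alone would allow an atom at \<open>x0\<close>; the density excludes it,
  since \<open>{..q}\<close> meets \<open>{x0..}\<close> in at most the null set
  \<open>{x0}\<close>.\<close>

lemma cdf_density_atLeast_eq_0:
  assumes "real_distribution M" and "has_positive_density_on_support M x0" and "q \<le> x0"
  shows "cdf M q = 0"
proof -
  interpret real_distribution M by fact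
  obtain f where f: "continuous_on {x0..} f"
    and M: "M = density lborel (\<lambda>q. ennreal (f q) * indicator {x0..} q)"
    using assms(2) unfolding has_positive_density_on_support_def by blast
  \<comment> \<open>As \<open>f\<close> is arbitrary off \<open>{x0..}\<close>, measurability is
    available only for its product with the indicator.\<close>
  have "(\<lambda>q. indicator {x0..} q *\<^sub>R f q) \<in> borel_measurable borel"
    using f by (intro borel_measurable_continuous_on_indicator) auto
  then have "(\<lambda>q. ennreal (indicator {x0..} q *\<^sub>R f q)) \<in> borel_measurable borel"
    by measurable
  also have "(\<lambda>q. ennreal (indicator {x0..} q *\<^sub>R f q)) =
      (\<lambda>q. ennreal (f q) * indicator {x0..} q)"
    by (auto simp: indicator_def)
  finally have meas: "(\<lambda>q. ennreal (f q) * indicator {x0..} q) \<in> borel_measurable lborel"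
    by simp
  have "emeasure M {..q} =
      (\<integral>\<^sup>+x. ennreal (f x) * indicator {x0..} x * indicator {..q} x \<partial>lborel)"
    unfolding M using meas by (subst emeasure_density) auto
  also have "\<dots> = (\<integral>\<^sup>+x. 0 \<partial>(lborel :: real measure))"
    using AE_lborel_singleton[of x0] \<open>q \<le> x0\<close>
    by (intro nn_integral_cong_AE) (auto simp: indicator_def)
  finally show ?thesis
    by (simp add: cdf_def measure_def)
qed

text \<open>The sequence \<open>b\<close> anticipates the minimum of the support. The three claims
  need a joint induction: vanishing up to \<open>b t\<close> places the cutoff \<open>a t\<close>
  beyond \<open>b t\<close>, where the survival formula for \<open>F t\<close> is available.\<close>

lemma equilibrium_survival:
  assumes eq: "equilibrium_allocation N I F0 a F"
    and n: "N - I > 1"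
    and zero: "\<And>q. q \<le> x0 \<Longrightarrow> F0 q = 0"
  defines "b \<equiv> (\<lambda>t. if t = 0 then x0 else a (t - 1))"
  shows "x0 \<le> b t \<and> (\<forall>q\<le>b t. F t q = 0) \<and>
    (\<forall>q\<ge>b t. 1 - F t q = (N - I) ^ t * (1 - F0 q))"
proof (induction t)
  case 0
  then show ?case using eq zero by (simp add: equilibrium_allocation_def b_def)
next
  case (Suc t)
  have clear: "(N - I) * (1 - F t (a t)) = 1"
    and motion: "\<And>q. F (Suc t) q = (if q \<le> a t then 0 else (N - I) * (F t q - F t (a t)))"
    using eq unfolding equilibrium_allocation_def by auto
  have b: "b (Suc t) = a t" by (simp add: b_def)
  \<comment> \<open>Clearing gives \<open>F t (a t) = 1 - 1 / (N - I)\<close>, which is positive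
    because \<open>N - I > 1\<close>.\<close>
  have "F t (a t) \<noteq> 0" using clear n by auto
  then have less: "b t < a t" using Suc.IH by (meson not_le)
  \<comment> \<open>The law of motion puts \<open>q = a t\<close> in its zero branch; market
    clearing makes the formula hold at this endpoint too.\<close>
  have survival: "1 - F (Suc t) q = (N - I) * (1 - F t q)" if "a t \<le> q" for q
  proof (cases "q = a t")
    case False
    then have "F (Suc t) q = (N - I) * (F t q - F t (a t))" using motion that by auto
    also have "\<dots> = (N - I) * (1 - F t (a t)) - (N - I) * (1 - F t q)"
      by (simp add: algebra_simps)
    finally show ?thesis using clear by simp
  qed (use motion clear in simp)
  show ?case
    unfolding b using less Suc.IH survival motion by (auto simp: mult.assoc)
qed

text \<open>On \<open>{b..}\<close> the survival function of \<open>F t\<close> is a positive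
  multiple of that of \<open>F0\<close>, so \<open>F t\<close> inherits strict monotonicity there,
  which identifies \<open>b\<close> as the minimum of the support.\<close>

lemma min_support_equilibrium:
  assumes eq: "equilibrium_allocation N I F0 a F"
    and n: "N - I > 1"
    and zero: "\<And>q. q \<le> x0 \<Longrightarrow> F0 q = 0"
    and mono: "strict_mono_on {x0..} F0"
  shows "x0 \<le> min_support (F t)"
    and "q \<le> min_support (F t) \<Longrightarrow> F t q = 0"
    and "min_support (F t) \<le> q \<Longrightarrow> 1 - F t q = (N - I) ^ t * (1 - F0 q)"
proof -
  obtain b where b: "x0 \<le> b" "\<And>q. q \<le> b \<Longrightarrow> F t q = 0"
    "\<And>q. b \<le> q \<Longrightarrow> 1 - F t q = (N - I) ^ t * (1 - F0 q)"
    using equilibrium_survival[OF eq n, of x0 t] zero by blast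
  have "strict_mono_on {b..} (F t)"
  proof (rule strict_mono_onI)
    fix p q assume pq: "p \<in> {b..}" "q \<in> {b..}" "p < q"
    then have "F0 p < F0 q" using b(1) by (intro strict_mono_onD[OF mono]) auto
    then have "(N - I) ^ t * (1 - F0 q) < (N - I) ^ t * (1 - F0 p)"
      using n by simp
    then show "F t p < F t q" using b(3)[of p] b(3)[of q] pq by simp
  qed
  then have "min_support (F t) = b" using b(2) by (intro min_support_eqI)
  then show "x0 \<le> min_support (F t)"
    and "q \<le> min_support (F t) \<Longrightarrow> F t q = 0"
    and "min_support (F t) \<le> q \<Longrightarrow> 1 - F t q = (N - I) ^ t * (1 - F0 q)"
    using b by auto
qed

theorem proposition3:
  fixes \<rho> m h N I x0 \<theta> :: real
    and M0 :: "real measure"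
    and a :: "nat \<Rightarrow> real"
    and F :: "nat \<Rightarrow> real \<Rightarrow> real"
  assumes "\<rho> > 0" and "h > 0" and "m > h"
    and "0 < I" and "I < N" and "N - I > 1"
    and "real_distribution M0"
    and "integrable M0 (\<lambda>q. q)"
    and "has_positive_density_on_support M0 x0"
    and "x0 > \<rho> * I / (h powr N * ((m / h) powr I - 1))"
    and "equilibrium_allocation N I (cdf M0) a F"
    and "0 < \<theta>" and "\<theta> < 1"
    and "regularly_varying (- 1 / \<theta>) (\<lambda>q. 1 - cdf M0 q)"
  shows "(\<forall>z. convergent (\<lambda>t. 1 - F t (z * min_support (F t)))) \<and>
    asymptotic_cdf F = pareto_cdf 1 (1 / \<theta>) \<and>
    (\<forall>z\<ge>1. asymptotic_cdf F z = 1 - z powr (- 1 / \<theta>)) \<and>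
    (\<forall>z\<ge>1. (\<lambda>t. F t (z * min_support (F t))
        - pareto_cdf (min_support (F t)) (1 / \<theta>) (z * min_support (F t))) \<longlonglongrightarrow> 0)"
proof -
  interpret M0: real_distribution M0 by fact
  define x where "x t = min_support (F t)" for t
  define S where "S q = 1 - cdf M0 q" for q
  have zero: "cdf M0 q = 0" if "q \<le> x0" for q
    using cdf_density_atLeast_eq_0 assms(7,9) that by blast
  have mono: "strict_mono_on {x0..} (cdf M0)"
    using assms(9) unfolding has_positive_density_on_support_def
    by (intro strict_mono_on_if_cdf_support) auto
  have equilibrium: "x0 \<le> x t" "q \<le> x t \<Longrightarrow> F t q = 0"
    "x t \<le> q \<Longrightarrow> 1 - F t q = (N - I) ^ t * S q" for t q
    unfolding x_def S_def
    using min_support_equilibrium[OF assms(11,6) zero mono] by blast+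
  \<comment> \<open>The lower bound on \<open>x0\<close> is thus positive, so all \<open>x t\<close>
    are positive and multiplication by \<open>z \<ge> 1\<close> moves \<open>x t\<close> to the
    right.\<close>
  have "(m / h) powr I > 1"
    using assms(2-4) by (intro gr_one_powr) auto
  then have "\<rho> * I / (h powr N * ((m / h) powr I - 1)) > 0"
    using assms(1,2,4) by simp
  then have x_pos: "0 < x t" for t using equilibrium(1)[of t] assms(10) by simp
  \<comment> \<open>Beyond \<open>x0\<close> the CDF increases strictly and is bounded by 1, so it
    never attains 1.\<close>
  have S_pos: "0 < S q" for q
  proof -
    have "cdf M0 q \<le> cdf M0 (max q x0)" by (intro M0.cdf_nondecreasing) simp
    also have "\<dots> < cdf M0 (max q x0 + 1)" by (intro strict_mono_onD[OF mono]) auto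
    also have "\<dots> \<le> 1" by (rule M0.cdf_bounded_prob)
    finally show ?thesis by (simp add: S_def)
  qed
  \<comment> \<open>Both descriptions of \<open>F t\<close> apply at the shared endpoint
    \<open>x t\<close>.\<close>
  have S_x: "(N - I) ^ t * S (x t) = 1" for t
    using equilibrium(2)[of "x t" t] equilibrium(3)[of t "x t"] by simp
  \<comment> \<open>\<open>S (x t)\<close> tends to 0, while \<open>S\<close> is nonincreasing and
    \<open>S K\<close> is positive, so \<open>x t\<close> eventually passes every
    \<open>K\<close>.\<close>
  have x_lim: "filterlim x at_top sequentially"
    unfolding filterlim_at_top
  proof
    fix K
    have "eventually (\<lambda>t. inverse ((N - I) ^ t) < S K) sequentially"
      by (rule order_tendstoD(2)[OF LIMSEQ_inverse_realpow_zero[OF assms(6)] S_pos])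
    then show "eventually (\<lambda>t. K \<le> x t) sequentially"
    proof eventually_elim
      case (elim t)
      show ?case
      proof (rule ccontr)
        assume "\<not> K \<le> x t"
        then have "S K \<le> S (x t)" unfolding S_def by (simp add: M0.cdf_nondecreasing)
        also have "S (x t) = inverse ((N - I) ^ t)"
          using S_x[of t] by (metis inverse_unique)
        finally show False using elim by simp
      qed
    qed
  qed
  have lim_ge: "(\<lambda>t. 1 - F t (z * x t)) \<longlonglongrightarrow> z powr (- 1 / \<theta>)" if z: "1 \<le> z" for z
  proof -
    have "((\<lambda>q. S (z * q) / S q) \<longlongrightarrow> z powr (- 1 / \<theta>)) at_top"
      using assms(14) z unfolding regularly_varying_def S_def by simp
    then have "(\<lambda>t. S (z * x t) / S (x t)) \<longlonglongrightarrow> z powr (- 1 / \<theta>)"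
      using x_lim by (rule filterlim_compose)
    moreover have "1 - F t (z * x t) = S (z * x t) / S (x t)" for t
    proof -
      have "x t \<le> z * x t" using z x_pos[of t] by simp
      then have "1 - F t (z * x t) = (N - I) ^ t * S (z * x t)" by (rule equilibrium(3))
      moreover have "(N - I) ^ t = 1 / S (x t)"
        using S_x[of t] S_pos[of "x t"] by (simp add: field_simps)
      ultimately show ?thesis by simp
    qed
    ultimately show ?thesis by simp
  qed
  \<comment> \<open>Equality of the two CDFs as functions also concerns \<open>z < 1\<close>, where
    \<open>z * x t\<close> lies to the left of the support.\<close>
  have lim_less: "(\<lambda>t. 1 - F t (z * x t)) \<longlonglongrightarrow> 1" if "z < 1" for z
  proof -
    have "z * x t \<le> x t" for t using that x_pos[of t] by simp
    then show ?thesis using equilibrium(2) by simp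
  qed
  have conv: "convergent (\<lambda>t. 1 - F t (z * x t))" for z
    using lim_ge[of z] lim_less[of z] unfolding convergent_def by (cases "1 \<le> z") auto
  have asym_ge: "asymptotic_cdf F z = 1 - z powr (- 1 / \<theta>)" if "1 \<le> z" for z
    using limI[OF lim_ge[OF that]] by (simp add: asymptotic_cdf_def x_def)
  have asym_less: "asymptotic_cdf F z = 0" if "z < 1" for z
    using limI[OF lim_less[OF that]] by (simp add: asymptotic_cdf_def x_def)
  have asym: "asymptotic_cdf F = pareto_cdf 1 (1 / \<theta>)"
    using asym_ge asym_less by (auto simp: pareto_cdf_def fun_eq_iff)
  \<comment> \<open>At \<open>z * x t\<close> the Pareto CDF of scale \<open>x t\<close> does not
    depend on \<open>t\<close>, so this restates \<open>lim_ge\<close>.\<close>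
  have "(\<lambda>t. F t (z * x t) - pareto_cdf (x t) (1 / \<theta>) (z * x t)) \<longlonglongrightarrow> 0"
    if z: "1 \<le> z" for z
  proof -
    have "pareto_cdf (x t) (1 / \<theta>) (z * x t) = 1 - z powr (- 1 / \<theta>)" for t
      using z x_pos[of t] by (simp add: pareto_cdf_def)
    then have "F t (z * x t) - pareto_cdf (x t) (1 / \<theta>) (z * x t) =
        z powr (- 1 / \<theta>) - (1 - F t (z * x t))" for t
      by simp
    moreover have "(\<lambda>t. z powr (- 1 / \<theta>) - (1 - F t (z * x t))) \<longlonglongrightarrow> 0"
      using tendsto_diff[OF tendsto_const lim_ge[OF z]] by (metis diff_self)
    ultimately show ?thesis by presburger
  qed
  then show ?thesis
    using conv asym asym_ge unfolding x_def by blast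
qed

end
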